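(* For any $R\geq \min_x W_t(x)$ we have $s(\Omega_{t,R})=s(W_t^{\Omega_{t,R}})\in K_t$. If $R$ is large enough that $K_s\subseteq \Omega_{t,R}$ for all $s<t$ then $s(\Omega_{t,R})=s(W_t)$.
   Context: Chasing convex bodies $K_1,K_2,\dots\subseteq\mathbb R^d$ starting at $0$; $W_t(x)$ is the work function (minimal cost of a path from $0$ satisfying requests $K_1,\dots,K_t$ and ending at $x$). $\Omega_{t,R}=\{x:W_t(x)\le R\}$ is the (convex) level set, and $W_t^{K}$ denotes the work function at time $t+1$ if $K_{t+1}=K$. For a convex body $K$, the Steiner point is $s(K)=\frac{1}{\mathrm{vol}(B_1)}\int_{v\in B_1}f_K(v)\,dv=d\,\frac{1}{|\mathbb S^{d-1}|}\int_{\theta\in\mathbb S^{d-1}}h_K(\theta)\theta\,d\theta$ with $f_K(v)=\arg\max_{x\in K}v\cdot x$ and $h_K(\theta)=\max_{x\in K}\theta\cdot x$. For a convex function $W$ with concave conjugate $W^*(v)=\min_w(W(w)-v^Tw)$ and $v^*=\arg\min_w(W(w)-v^Tw)$, the functional Steiner point is $s(W)=\frac{1}{\mathrm{vol}(B_1)}\int_{v\in B_1}v^*\,dv=-d\,\frac{1}{|\mathbb S^{d-1}|}\int_{\mathbb S^{d-1}}W^*(\theta)\theta\,d\theta$.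
   Formalization: In the second claim, K_s ⊆ Ω_{t,R} is assumed for all s ≤ t instead of s < t, since with s < t it fails: for t = 1, K_1 = {1}×[0,2], R = 1, Ω is the point (1,0) but s(W_1) has positive second coordinate. *)

theory Defs
  imports "HOL-Analysis.Analysis"
begin

text \<open>Convex bodies may have empty interior: the level set of a work function at its minimal
  value, whose Steiner point is considered below, can be a single point.\<close>

definition convex_body :: "'a::euclidean_space set \<Rightarrow> bool" where
  "convex_body K \<longleftrightarrow> convex K \<and> compact K \<and> K \<noteq> {}"

text \<open>The requests are \<open>K 1, K 2, \<dots>\<close>; the value \<open>K 0\<close> is irrelevant. A path is given by its
  positions \<open>p 0 = 0, p 1, \<dots>, p t\<close>, after which it moves to its endpoint \<open>x\<close>.\<close>

definition satisfies_requests :: "(nat \<Rightarrow> 'a::euclidean_space set) \<Rightarrow> nat \<Rightarrow> (nat \<Rightarrow> 'a) \<Rightarrow> bool" where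
  "satisfies_requests K t p \<longleftrightarrow> p 0 = 0 \<and> (\<forall>s\<in>{1..t}. p s \<in> K s)"

definition path_cost :: "nat \<Rightarrow> (nat \<Rightarrow> 'a::euclidean_space) \<Rightarrow> 'a \<Rightarrow> real" where
  "path_cost t p x = (\<Sum>s=1..t. dist (p (s - 1)) (p s)) + dist (p t) x"

definition work_fun :: "(nat \<Rightarrow> 'a::euclidean_space set) \<Rightarrow> nat \<Rightarrow> 'a \<Rightarrow> real" where
  "work_fun K t x = (INF p\<in>{p. satisfies_requests K t p}. path_cost t p x)"

definition level_set :: "(nat \<Rightarrow> 'a::euclidean_space set) \<Rightarrow> nat \<Rightarrow> real \<Rightarrow> 'a set" where
  "level_set K t R = {x. work_fun K t x \<le> R}"

definition work_fun_next ::
    "(nat \<Rightarrow> 'a::euclidean_space set) \<Rightarrow> nat \<Rightarrow> 'a set \<Rightarrow> 'a \<Rightarrow> real" where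
  "work_fun_next K t L = work_fun (K(Suc t := L)) (Suc t)"

text \<open>The extremal points below are chosen arbitrarily where they are not unique, which for convex
  bodies and for work functions happens only on a null set of directions. The integrals are taken
  over the complete measure \<open>lebesgue\<close> (not \<open>lborel\<close>), so that this choice affects neither
  measurability nor the value.\<close>

definition steiner_point :: "'a::euclidean_space set \<Rightarrow> 'a" where
  "steiner_point K =
     (1 / measure lebesgue (cball (0::'a) 1)) *\<^sub>R
       (LINT v:cball 0 1|lebesgue. arg_max_on (\<lambda>x. v \<bullet> x) K)"

definition functional_steiner_point :: "('a::euclidean_space \<Rightarrow> real) \<Rightarrow> 'a" where
  "functional_steiner_point W =
     (1 / measure lebesgue (cball (0::'a) 1)) *\<^sub>R
       (LINT v:cball 0 1|lebesgue. arg_min_on (\<lambda>w. W w - v \<bullet> w) UNIV)"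

end

theory Submission
  imports Defs
begin

text \<open>Let \<open>L\<close> be the level set, \<open>W\<close> the work function, \<open>f v = max {v \<bullet> y - W y | y \<in> L}\<close> and
  \<open>g v = max {v \<bullet> y - R | y \<in> L}\<close>. Both are convex and Lipschitz, and they agree where
  \<open>norm v \<ge> 1\<close> because \<open>W\<close> is 1-Lipschitz. The points averaged by the two kinds of Steiner point are
  subgradients of \<open>f\<close> and \<open>g\<close>. Instead of integrating by parts over the ball, one uses that the
  difference quotients of the compactly supported function \<open>f - g\<close> have integral 0 by translation
  invariance, and passes to the limit by dominated convergence. For \<open>norm v < 1\<close> a minimizer of
  \<open>W w - v \<bullet> w\<close> lies in \<open>K t\<close>: the last leg of an optimal path would otherwise cost more than it
  gains. Averaging over \<open>v\<close> stays in \<open>K t\<close>.\<close>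

section \<open>Translation invariance and integrability for Lebesgue measure\<close>

lemma lborel_integral_translation:
  fixes f :: "'a::euclidean_space \<Rightarrow> real"
  assumes [measurable]: "f \<in> borel_measurable borel"
  shows "(\<integral>v. f (v + a) \<partial>lborel) = (\<integral>v. f v \<partial>lborel)"
proof -
  have "(\<integral>v. f v \<partial>lborel) = (\<integral>v. f v \<partial>distr lborel borel ((+) a))"
    by (simp add: lborel_distr_plus)
  also have "\<dots> = (\<integral>v. f (v + a) \<partial>lborel)"
    by (subst integral_distr) (auto simp: add.commute)
  finally show ?thesis by simp
qed

lemma lborel_integrable_translation:
  fixes f :: "'a::euclidean_space \<Rightarrow> real"
  assumes "integrable lborel f"
  shows "integrable lborel (\<lambda>v. f (v + a))"
proof -
  have "integrable (distr lborel borel ((+) a)) f"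
    using assms by (simp add: lborel_distr_plus)
  then show ?thesis
    by (subst (asm) integrable_distr_eq) (use assms in \<open>auto simp: add.commute\<close>)
qed

lemma integrable_continuous_bounded_support:
  fixes f :: "'a::euclidean_space \<Rightarrow> real"
  assumes "continuous_on UNIV f" and "\<And>v. v \<notin> cball 0 r \<Longrightarrow> f v = 0"
  shows "integrable lborel f"
proof -
  have "integrable lborel (\<lambda>v. indicator (cball 0 r) v *\<^sub>R f v)"
    by (rule borel_integrable_compact) (auto intro: continuous_on_subset[OF assms(1)])
  also have "(\<lambda>v. indicator (cball 0 r) v *\<^sub>R f v) = f"
    using assms(2) by (force simp: indicator_def)
  finally show ?thesis .
qed

lemma integrable_indicator_cball_mult:
  "integrable lborel (\<lambda>v::'a::euclidean_space. indicator (cball 0 r) v * (c::real))"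
  by (intro integrable_mult_left integrable_real_indicator)
     (use emeasure_bounded_finite[of "cball 0 r"] in auto)

section \<open>Difference quotients of convex Lipschitz functions\<close>

lemma convex_difference_quotient_mono:
  fixes f :: "'a::real_vector \<Rightarrow> real"
  assumes "convex_on UNIV f" and "0 < s" and "s \<le> t"
  shows "(f (v + s *\<^sub>R e) - f v) / s \<le> (f (v + t *\<^sub>R e) - f v) / t"
proof -
  have "f ((1 - s/t) *\<^sub>R v + (s/t) *\<^sub>R (v + t *\<^sub>R e)) \<le> (1 - s/t) * f v + (s/t) * f (v + t *\<^sub>R e)"
    using assms by (intro convex_onD) auto
  moreover have "(1 - s/t) *\<^sub>R v + (s/t) *\<^sub>R (v + t *\<^sub>R e) = v + s *\<^sub>R e"
    using assms by (simp add: algebra_simps)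
  ultimately show ?thesis
    using assms by (simp add: field_simps)
qed

text \<open>The division is by \<open>s\<close>, not by its square: for convex \<open>f\<close>, as
  \<open>s\<close> tends to 0, the value tends to the gap between the right and the left derivative
  along \<open>e\<close>.\<close>

definition second_difference :: "('a::real_vector \<Rightarrow> real) \<Rightarrow> 'a \<Rightarrow> real \<Rightarrow> 'a \<Rightarrow> real" where
  "second_difference f e s v = (f (v + s *\<^sub>R e) - f v) / s + (f (v - s *\<^sub>R e) - f v) / s"

lemma second_difference_mono:
  assumes "convex_on UNIV f" and "0 < s" and "s \<le> t"
  shows "second_difference f e s v \<le> second_difference f e t v"
  using convex_difference_quotient_mono[OF assms, of v e]
    convex_difference_quotient_mono[OF assms, of v "- e"]
  unfolding second_difference_def by simp

lemma second_difference_nonneg: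
  assumes "convex_on UNIV f" and "0 < s"
  shows "0 \<le> second_difference f e s v"
proof -
  have "f ((1 - 1/2) *\<^sub>R (v + s *\<^sub>R e) + (1/2) *\<^sub>R (v - s *\<^sub>R e))
      \<le> (1 - 1/2) * f (v + s *\<^sub>R e) + (1/2) * f (v - s *\<^sub>R e)"
    by (intro convex_onD[OF assms(1)]) auto
  moreover have "(1 - 1/2) *\<^sub>R (v + s *\<^sub>R e) + (1/2) *\<^sub>R (v - s *\<^sub>R e) = v"
    by (simp add: algebra_simps flip: scaleR_left_distrib)
  ultimately have "0 \<le> (f (v + s *\<^sub>R e) - f v + (f (v - s *\<^sub>R e) - f v)) / s"
    using assms(2) by (intro divide_nonneg_pos) auto
  then show ?thesis
    unfolding second_difference_def add_divide_distrib .
qed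

lemma lipschitz_difference_quotient_le:
  fixes f :: "'a::real_normed_vector \<Rightarrow> real"
  assumes "M-lipschitz_on UNIV f" and "norm e \<le> 1" and "0 < s"
  shows "\<bar>(f (v + s *\<^sub>R e) - f v) / s\<bar> \<le> M"
proof -
  have "0 \<le> M" using assms(1) by (rule lipschitz_on_nonneg)
  have "\<bar>f (v + s *\<^sub>R e) - f v\<bar> \<le> M * norm (s *\<^sub>R e)"
    using lipschitz_onD[OF assms(1), of "v + s *\<^sub>R e" v] by (simp add: dist_real_def dist_norm)
  also have "\<dots> \<le> M * s"
    using assms \<open>0 \<le> M\<close> by (intro mult_left_mono) (auto simp: mult_left_le)
  finally show ?thesis
    using assms(3) by (simp add: field_simps)
qed

text \<open>Moving the translation in the backward quotient onto the weight \<open>1 - norm v\<close>, whose own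
  increments are at most \<open>s\<close>, gains a factor \<open>s\<close>.\<close>

lemma integral_second_difference_le:
  fixes f :: "'a::euclidean_space \<Rightarrow> real"
  assumes f: "M-lipschitz_on UNIV f" and e: "norm e \<le> 1" and s: "0 < s" "s \<le> 1"
  defines "\<phi> \<equiv> \<lambda>v::'a. max 0 (1 - norm v)"
  shows "integrable lborel (\<lambda>v. \<phi> v * second_difference f e s v)"
    and "(\<integral>v. \<phi> v * second_difference f e s v \<partial>lborel) \<le> s * M * measure lborel (cball (0::'a) 2)"
proof -
  have M: "0 \<le> M" using f by (rule lipschitz_on_nonneg)
  have cont_f: "continuous_on A f" for A
    using lipschitz_on_continuous_on[OF f] continuous_on_subset by blast
  have cont_f': "continuous_on UNIV (\<lambda>v. f (v + a))" for a
    by (rule continuous_on_compose2[OF cont_f[of UNIV]]) (auto intro: continuous_intros)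
  have se: "norm (s *\<^sub>R e) \<le> s"
    using e s by (simp add: mult_left_le)
  define D where "D = (\<lambda>v. (f (v + s *\<^sub>R e) - f v) / s)"
  have D_le: "\<bar>D v\<bar> \<le> M" for v
    unfolding D_def using f e s(1) by (rule lipschitz_difference_quotient_le)
  have cont_D: "continuous_on UNIV D"
    unfolding D_def using s by (intro continuous_intros cont_f cont_f') auto
  have cont_D': "continuous_on UNIV (\<lambda>v. D (v + a))" for a
    by (rule continuous_on_compose2[OF cont_D]) (auto intro: continuous_intros)
  have cont_\<phi>: "continuous_on UNIV \<phi>"
    unfolding \<phi>_def by (intro continuous_intros)
  define P where "P = (\<lambda>v. \<phi> v * D v)"
  \<comment> \<open>\<open>D\<close> at the point shifted back by \<open>s *\<^sub>R e\<close> is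
    minus the backward quotient of \<open>f\<close> at \<open>v\<close>, so the integrand is
    \<open>P v - Q v\<close>.\<close>
  define Q where "Q = (\<lambda>v. \<phi> v * D (v + (- (s *\<^sub>R e))))"
  have cont_D'': "continuous_on UNIV (\<lambda>v. D (v + (- (s *\<^sub>R e))))"
    by (rule cont_D')
  have \<phi>0: "\<phi> v = 0" if "v \<notin> cball 0 1" for v
    using that by (simp add: \<phi>_def)
  have P: "integrable lborel P" and Q: "integrable lborel Q"
    unfolding P_def Q_def using \<phi>0 cont_D cont_D'' cont_\<phi>
    by (intro integrable_continuous_bounded_support[where r = 1] continuous_on_mult; simp)+
  have eq: "\<phi> v * second_difference f e s v = P v - Q v" for v
    using s by (simp add: P_def Q_def D_def second_difference_def field_simps)
  show "integrable lborel (\<lambda>v. \<phi> v * second_difference f e s v)"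
    unfolding eq using P Q by (rule Bochner_Integration.integrable_diff)
  have Q': "(\<integral>v. Q v \<partial>lborel) = (\<integral>v. Q (v + s *\<^sub>R e) \<partial>lborel)"
    using Q by (intro lborel_integral_translation[symmetric]) auto
  have "(\<integral>v. \<phi> v * second_difference f e s v \<partial>lborel) = (\<integral>v. P v - Q (v + s *\<^sub>R e) \<partial>lborel)"
    unfolding eq using P Q lborel_integrable_translation[OF Q] Q' by simp
  \<comment> \<open>Radius 2 suffices: as \<open>s \<le> 1\<close>, for \<open>norm v > 2\<close>
    both \<open>v\<close> and \<open>v + s *\<^sub>R e\<close> lie outside the unit ball, where the
    weight \<open>\<phi>\<close> vanishes.\<close>
  also have "\<dots> \<le> (\<integral>v. indicator (cball (0::'a) 2) v * (s * M) \<partial>lborel)"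
  proof (rule Bochner_Integration.integral_mono)
    show "integrable lborel (\<lambda>v. P v - Q (v + s *\<^sub>R e))"
      using P lborel_integrable_translation[OF Q] by (rule Bochner_Integration.integrable_diff)
    show "integrable lborel (\<lambda>v::'a. indicator (cball 0 2) v * (s * M))"
      by (rule integrable_indicator_cball_mult)
    fix v :: 'a
    have *: "P v - Q (v + s *\<^sub>R e) = (\<phi> v - \<phi> (v + s *\<^sub>R e)) * D v"
      by (simp add: P_def Q_def algebra_simps)
    have tri: "\<bar>norm (v + s *\<^sub>R e) - norm v\<bar> \<le> s"
      using norm_triangle_ineq3[of "v + s *\<^sub>R e" v] se by simp
    show "P v - Q (v + s *\<^sub>R e) \<le> indicator (cball 0 2) v * (s * M)"
    proof (cases "v \<in> cball 0 2")
      case True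
      have "\<bar>\<phi> v - \<phi> (v + s *\<^sub>R e)\<bar> \<le> s"
        using tri by (auto simp: \<phi>_def max_def)
      then have "\<bar>(\<phi> v - \<phi> (v + s *\<^sub>R e)) * D v\<bar> \<le> s * M"
        unfolding abs_mult using D_le s M by (intro mult_mono) auto
      then show ?thesis using True * by simp
    next
      case False
      then have "norm v > 2" "norm (v + s *\<^sub>R e) > 1" using tri s by auto
      then show ?thesis using False * by (simp add: \<phi>_def)
    qed
  qed
  also have "\<dots> = s * M * measure lborel (cball (0::'a) 2)"
    by simp
  finally show "(\<integral>v. \<phi> v * second_difference f e s v \<partial>lborel)
    \<le> s * M * measure lborel (cball (0::'a) 2)" .
qed

text \<open>For fixed \<open>v\<close> the second difference decreases to a nonnegative limit as the
  step shrinks. Its integral against the weight \<open>max 0 (1 - norm v)\<close> is at most a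
  constant times the step, so the limit has weighted integral 0 and vanishes almost everywhere in
  the open ball, where the weight is positive. This is almost everywhere differentiability of a
  convex function along one direction.\<close>

lemma AE_second_difference_tendsto_0:
  fixes f :: "'a::euclidean_space \<Rightarrow> real"
  assumes cvx: "convex_on UNIV f" and f: "M-lipschitz_on UNIV f" and e: "norm e \<le> 1"
  shows "AE v in lborel. v \<in> ball 0 1 \<longrightarrow>
    (\<lambda>n. second_difference f e (1 / real (Suc n)) v) \<longlonglongrightarrow> 0"
proof -
  define \<phi> where "\<phi> = (\<lambda>v::'a. max 0 (1 - norm v))"
  define S where "S = (\<lambda>n v. second_difference f e (1 / real (Suc n)) v)"
  define L where "L = (\<lambda>v. lim (\<lambda>n. S n v))"
  have M: "0 \<le> M" using f by (rule lipschitz_on_nonneg)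
  have S0: "0 \<le> S n v" for n v
    unfolding S_def by (intro second_difference_nonneg cvx) auto
  have "decseq (\<lambda>n. S n v)" for v
    unfolding decseq_def S_def by (auto intro!: second_difference_mono cvx simp: frac_le)
  then have "convergent (\<lambda>n. S n v)" for v
    using decseq_convergent[of "\<lambda>n. S n v" 0] S0 unfolding convergent_def by blast
  then have lim: "(\<lambda>n. S n v) \<longlonglongrightarrow> L v" for v
    unfolding L_def by (simp add: convergent_LIMSEQ_iff)
  have L0: "0 \<le> L v" for v
    using lim[of v] S0 by (intro LIMSEQ_le_const) auto
  have S_le: "\<bar>S n v\<bar> \<le> 2 * M" for n v
    using lipschitz_difference_quotient_le[OF f e, of "1 / real (Suc n)" v]
      lipschitz_difference_quotient_le[OF f, of "- e" "1 / real (Suc n)" v] e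
    unfolding S_def second_difference_def by auto
  have int: "integrable lborel (\<lambda>v. \<phi> v * S n v)"
    and le: "(\<integral>v. \<phi> v * S n v \<partial>lborel) \<le> 1 / real (Suc n) * M * measure lborel (cball (0::'a) 2)" for n
    unfolding \<phi>_def S_def
    using integral_second_difference_le[OF f e, of "1 / real (Suc n)"] by auto
  have [measurable]: "\<phi> \<in> borel_measurable borel"
    unfolding \<phi>_def by measurable
  have [measurable]: "f \<in> borel_measurable borel"
    using lipschitz_on_continuous_on[OF f] by (rule borel_measurable_continuous_onI)
  have S_meas[measurable]: "S n \<in> borel_measurable borel" for n
    unfolding S_def second_difference_def by measurable
  have [measurable]: "L \<in> borel_measurable borel"
    by (rule borel_measurable_LIMSEQ_real[where u = S]) (auto intro: lim)
  define w where "w = (\<lambda>v::'a. indicator (cball 0 1) v * (2 * M))"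
  have w: "integrable lborel w"
    unfolding w_def by (rule integrable_indicator_cball_mult)
  have bound: "norm (\<phi> v * S n v) \<le> w v" for n v
  proof (cases "v \<in> cball 0 1")
    case True
    then have "\<bar>\<phi> v\<bar> * \<bar>S n v\<bar> \<le> 1 * (2 * M)"
      using S_le M by (intro mult_mono) (auto simp: \<phi>_def)
    then show ?thesis using True by (simp add: w_def abs_mult)
  qed (simp add: \<phi>_def w_def)
  have lim': "(\<lambda>n. \<phi> v * S n v) \<longlonglongrightarrow> \<phi> v * L v" for v
    by (intro tendsto_intros lim)
  have meas1: "(\<lambda>v. \<phi> v * L v) \<in> borel_measurable lborel"
    and meas2: "(\<lambda>v. \<phi> v * S n v) \<in> borel_measurable lborel" for n
    by measurable
  note dom = meas1 meas2 w AE_I2[OF lim'] AE_I2[OF bound]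
  have intL: "integrable lborel (\<lambda>v. \<phi> v * L v)"
    by (rule integrable_dominated_convergence[OF dom])
  have "(\<lambda>n. \<integral>v. \<phi> v * S n v \<partial>lborel) \<longlonglongrightarrow> (\<integral>v. \<phi> v * L v \<partial>lborel)"
    by (rule integral_dominated_convergence[OF dom])
  moreover have "(\<lambda>n. 1 / real (Suc n) * M * measure lborel (cball (0::'a) 2)) \<longlonglongrightarrow> 0"
    using LIMSEQ_Suc[OF lim_1_over_n] by (intro tendsto_mult_left_zero) simp
  ultimately have "(\<integral>v. \<phi> v * L v \<partial>lborel) \<le> 0"
    using le by (intro LIMSEQ_le) auto
  moreover have nonneg: "0 \<le> \<phi> v * L v" for v
    using L0 by (simp add: \<phi>_def)
  ultimately have "(\<integral>v. \<phi> v * L v \<partial>lborel) = 0"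
    by (simp add: antisym)
  then have "AE v in lborel. \<phi> v * L v = 0"
    using integral_nonneg_eq_0_iff_AE[OF intL] nonneg by simp
  then show ?thesis
  proof (rule AE_mp, intro AE_I2 impI)
    fix v :: 'a assume "\<phi> v * L v = 0" "v \<in> ball 0 1"
    then have "L v = 0" by (simp add: \<phi>_def max_def split: if_splits)
    then show "(\<lambda>n. second_difference f e (1 / real (Suc n)) v) \<longlonglongrightarrow> 0"
      using lim[of v] by (simp add: S_def)
  qed
qed

definition subgradient :: "('a::real_inner \<Rightarrow> real) \<Rightarrow> 'a \<Rightarrow> 'a \<Rightarrow> bool" where
  "subgradient f v p \<longleftrightarrow> (\<forall>u. f v + p \<bullet> (u - v) \<le> f u)"

text \<open>The forward quotient is at least \<open>p v \<bullet> e\<close>, and the subgradient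
  inequality at \<open>v - s *\<^sub>R e\<close> bounds it above by that value plus the second
  difference. Where the second difference tends to 0, every choice of subgradient therefore gives
  the same limit.\<close>

lemma AE_difference_quotient_tendsto_subgradient:
  fixes f :: "'a::euclidean_space \<Rightarrow> real"
  assumes cvx: "convex_on UNIV f" and f: "M-lipschitz_on UNIV f" and e: "norm e \<le> 1"
    and p: "\<And>v. v \<in> ball 0 1 \<Longrightarrow> subgradient f v (p v)"
  shows "AE v in lborel. v \<in> ball 0 1 \<longrightarrow>
    (\<lambda>n. (f (v + (1 / real (Suc n)) *\<^sub>R e) - f v) / (1 / real (Suc n))) \<longlonglongrightarrow> p v \<bullet> e"
  using AE_second_difference_tendsto_0[OF cvx f e]
proof (rule AE_mp, intro AE_I2 impI)
  fix v :: 'a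
  assume v: "v \<in> ball 0 1" and "v \<in> ball 0 1 \<longrightarrow>
    (\<lambda>n. second_difference f e (1 / real (Suc n)) v) \<longlonglongrightarrow> 0"
  then have lim: "(\<lambda>n. p v \<bullet> e + second_difference f e (1 / real (Suc n)) v) \<longlonglongrightarrow> p v \<bullet> e + 0"
    by (intro tendsto_intros) auto
  have plus: "p v \<bullet> e \<le> (f (v + s *\<^sub>R e) - f v) / s" and
    minus: "- (p v \<bullet> e) \<le> (f (v - s *\<^sub>R e) - f v) / s" if "0 < s" for s
  proof -
    have *: "f v + p v \<bullet> (u - v) \<le> f u" for u
      using p[OF v] by (simp add: subgradient_def)
    show "p v \<bullet> e \<le> (f (v + s *\<^sub>R e) - f v) / s"
      using *[of "v + s *\<^sub>R e"] that by (simp add: field_simps)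
    show "- (p v \<bullet> e) \<le> (f (v - s *\<^sub>R e) - f v) / s"
      using *[of "v - s *\<^sub>R e"] that by (simp add: field_simps)
  qed
  show "(\<lambda>n. (f (v + (1 / real (Suc n)) *\<^sub>R e) - f v) / (1 / real (Suc n))) \<longlonglongrightarrow> p v \<bullet> e"
  proof (rule tendsto_sandwich[where f = "\<lambda>_. p v \<bullet> e"
        and h = "\<lambda>n. p v \<bullet> e + second_difference f e (1 / real (Suc n)) v"])
    show "(\<lambda>n. p v \<bullet> e + second_difference f e (1 / real (Suc n)) v) \<longlonglongrightarrow> p v \<bullet> e"
      using lim by simp
    show "\<forall>\<^sub>F n in sequentially. p v \<bullet> e \<le> (f (v + (1 / real (Suc n)) *\<^sub>R e) - f v) / (1 / real (Suc n))"
      by (intro always_eventually allI plus) simp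
    show "\<forall>\<^sub>F n in sequentially. (f (v + (1 / real (Suc n)) *\<^sub>R e) - f v) / (1 / real (Suc n))
      \<le> p v \<bullet> e + second_difference f e (1 / real (Suc n)) v"
    proof (intro always_eventually allI)
      fix n
      show "(f (v + (1 / real (Suc n)) *\<^sub>R e) - f v) / (1 / real (Suc n))
        \<le> p v \<bullet> e + second_difference f e (1 / real (Suc n)) v"
        unfolding second_difference_def using minus[of "1 / real (Suc n)"] by simp
    qed
  qed simp
qed

text \<open>Since \<open>lebesgue\<close> is complete, a set differing from a measurable one by a
  null set is measurable. This handles choices of extremal points that are determined only almost
  everywhere.\<close>

lemma borel_measurable_lebesgue_AE_eq:
  fixes f g :: "'a::euclidean_space \<Rightarrow> 'b::topological_space"
  assumes g: "g \<in> borel_measurable lebesgue" and "AE x in lebesgue. f x = g x"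
  shows "f \<in> borel_measurable lebesgue"
proof (rule measurableI)
  fix A :: "'b set" assume A: "A \<in> sets borel"
  show "f -` A \<inter> space lebesgue \<in> sets lebesgue"
  proof (rule completion.in_sets_AE)
    show "AE x in lebesgue. x \<in> g -` A \<inter> space lebesgue \<longleftrightarrow> x \<in> f -` A \<inter> space lebesgue"
      using assms(2) by eventually_elim auto
    show "g -` A \<inter> space lebesgue \<in> sets lebesgue"
      using measurable_sets[OF g A] .
  qed auto
qed auto

text \<open>Nothing is assumed about the measurability of \<open>p\<close>: it is inherited from the
  difference quotients of \<open>f\<close>, which converge to \<open>p v \<bullet> e\<close> almost
  everywhere in the ball. Their common bound \<open>M\<close> passes to the limit.\<close>

lemma subgradient_integrable_component:
  fixes f :: "'a::euclidean_space \<Rightarrow> real"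
  assumes cvx: "convex_on UNIV f" and f: "M-lipschitz_on UNIV f" and e: "norm e \<le> 1"
    and p: "\<And>v. v \<in> ball 0 1 \<Longrightarrow> subgradient f v (p v)"
  shows "integrable lebesgue (\<lambda>v. indicator (ball 0 1) v * (p v \<bullet> e))"
proof -
  define D where "D = (\<lambda>n v. (f (v + (1 / real (Suc n)) *\<^sub>R e) - f v) / (1 / real (Suc n)))"
  \<comment> \<open>Where the sequence diverges, \<open>lim\<close> has one fixed arbitrary value,
    so \<open>L\<close> is Borel measurable on the whole space.\<close>
  define L where "L = (\<lambda>v. lim (\<lambda>n. indicator (ball 0 1) v * D n v))"
  have [measurable]: "f \<in> borel_measurable borel"
    using lipschitz_on_continuous_on[OF f] by (rule borel_measurable_continuous_onI)
  have [measurable]: "D n \<in> borel_measurable borel" for n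
    unfolding D_def by measurable
  have L: "L \<in> borel_measurable lebesgue"
  proof (rule measurable_completion)
    have [measurable]: "ball (0::'a) 1 \<in> sets borel" by simp
    show "L \<in> borel_measurable lborel" unfolding L_def by measurable
  qed
  have ae: "AE v in lebesgue. v \<in> ball 0 1 \<longrightarrow> (\<lambda>n. D n v) \<longlonglongrightarrow> p v \<bullet> e"
    using AE_difference_quotient_tendsto_subgradient[OF cvx f e p]
    unfolding D_def by (rule AE_completion)
  have eq: "AE v in lebesgue. indicator (ball 0 1) v * (p v \<bullet> e) = L v"
    using ae
  proof (eventually_elim)
    case (elim v)
    then have "(\<lambda>n. indicator (ball 0 1) v * D n v) \<longlonglongrightarrow> indicator (ball 0 1) v * (p v \<bullet> e)"
      by (cases "v \<in> ball 0 1") auto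
    then show ?case unfolding L_def by (rule limI[symmetric])
  qed
  have D_le: "\<bar>D n v\<bar> \<le> M" for n v
    unfolding D_def using f e by (rule lipschitz_difference_quotient_le) simp
  have bound: "AE v in lebesgue. norm (indicator (ball 0 1) v * (p v \<bullet> e))
      \<le> norm (indicator (ball 0 1) v * M)"
    using ae
  proof (eventually_elim)
    case (elim v)
    show ?case
    proof (cases "v \<in> ball 0 1")
      case True
      then have "(\<lambda>n. \<bar>D n v\<bar>) \<longlonglongrightarrow> \<bar>p v \<bullet> e\<bar>"
        using elim by (intro tendsto_intros) auto
      then have "\<bar>p v \<bullet> e\<bar> \<le> M"
        using D_le by (intro LIMSEQ_le_const2) auto
      then show ?thesis using True by simp
    qed simp
  qed
  have w: "integrable lebesgue (\<lambda>v::'a. indicator (ball 0 1) v * M)"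
    by (intro integrable_mult_left integrable_real_indicator)
       (use emeasure_bounded_finite[of "ball (0::'a) 1"] in auto)
  show ?thesis
    using w borel_measurable_lebesgue_AE_eq[OF L eq] bound
    by (rule Bochner_Integration.integrable_bound)
qed

text \<open>The unit sphere is a null set. The Steiner points integrate over the closed ball,
  whereas the extremal points of work functions are controlled only for
  \<open>norm v < 1\<close>.\<close>

lemma set_integral_cball_eq_ball:
  fixes g :: "'a::euclidean_space \<Rightarrow> 'b::{banach, second_countable_topology}"
  assumes "set_integrable lebesgue (ball 0 1) g"
  shows "(LINT v:cball 0 1|lebesgue. g v) = (LINT v:ball 0 1|lebesgue. g v)"
proof -
  have "AE v::'a in lebesgue. v \<notin> sphere 0 1"
    by (intro AE_not_in) (simp add: negligible_sphere flip: negligible_iff_null_sets)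
  then have ae: "AE v in lebesgue. indicator (cball 0 1) v *\<^sub>R g v = indicator (ball 0 1) v *\<^sub>R g v"
    by eventually_elim (auto simp: indicator_def)
  have int: "integrable lebesgue (\<lambda>v. indicator (ball 0 1) v *\<^sub>R g v)"
    using assms by (simp add: set_integrable_def)
  have meas: "(\<lambda>v. indicator (cball 0 1) v *\<^sub>R g v) \<in> borel_measurable lebesgue"
    using borel_measurable_integrable[OF int] ae by (rule borel_measurable_lebesgue_AE_eq)
  show "(LINT v:cball 0 1|lebesgue. g v) = (LINT v:ball 0 1|lebesgue. g v)"
    unfolding set_lebesgue_integral_def
    using meas borel_measurable_integrable[OF int] ae by (rule integral_cong_AE)
qed

lemma subgradient_set_integrable:
  fixes f :: "'a::euclidean_space \<Rightarrow> real"
  assumes cvx: "convex_on UNIV f" and f: "M-lipschitz_on UNIV f"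
    and p: "\<And>v. v \<in> ball 0 1 \<Longrightarrow> subgradient f v (p v)"
  shows "set_integrable lebesgue (ball 0 1) p"
proof -
  have "integrable lebesgue (\<lambda>v. \<Sum>b\<in>Basis. (indicator (ball 0 1) v * (p v \<bullet> b)) *\<^sub>R b)"
    using subgradient_integrable_component[OF cvx f _ p]
    by (intro Bochner_Integration.integrable_sum integrable_scaleR_left) auto
  also have "(\<lambda>v. \<Sum>b\<in>Basis. (indicator (ball 0 1) v * (p v \<bullet> b)) *\<^sub>R b)
      = (\<lambda>v. indicator (ball 0 1) v *\<^sub>R p v)"
  proof
    fix v
    have "indicator (ball 0 1) v *\<^sub>R p v = indicator (ball 0 1) v *\<^sub>R (\<Sum>b\<in>Basis. (p v \<bullet> b) *\<^sub>R b)"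
      by (simp add: euclidean_representation)
    then show "(\<Sum>b\<in>Basis. (indicator (ball 0 1) v * (p v \<bullet> b)) *\<^sub>R b) = indicator (ball 0 1) v *\<^sub>R p v"
      by (simp add: scaleR_sum_right)
  qed
  finally show ?thesis unfolding set_integrable_def .
qed

text \<open>This takes the role of the divergence theorem: the integral of a gradient over the ball
  is determined by the values of the function on the boundary. The claim is checked one coordinate
  \<open>e\<close> at a time.\<close>

theorem subgradient_integral_eq:
  fixes f g :: "'a::euclidean_space \<Rightarrow> real"
  assumes f: "convex_on UNIV f" "M-lipschitz_on UNIV f"
    and p: "\<And>v. v \<in> ball 0 1 \<Longrightarrow> subgradient f v (p v)"
    and g: "convex_on UNIV g" "M-lipschitz_on UNIV g"
    and q: "\<And>v. v \<in> ball 0 1 \<Longrightarrow> subgradient g v (q v)"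
    and fg: "\<And>v. 1 \<le> norm v \<Longrightarrow> f v = g v"
  shows "(LINT v:ball 0 1|lebesgue. p v) = (LINT v:ball 0 1|lebesgue. q v)"
proof (rule euclidean_eqI)
  fix e :: 'a assume "e \<in> Basis"
  then have e: "norm e \<le> 1" by simp
  define h where "h = (\<lambda>v. f v - g v)"
  define D where "D = (\<lambda>n v. (h (v + (1 / real (Suc n)) *\<^sub>R e) - h v) / (1 / real (Suc n)))"
  define l where "l = (\<lambda>v. indicator (ball 0 1) v * (p v \<bullet> e) - indicator (ball 0 1) v * (q v \<bullet> e))"
  have M: "0 \<le> M" using f(2) by (rule lipschitz_on_nonneg)
  have cont: "continuous_on UNIV h"
    unfolding h_def using f(2) g(2) by (intro continuous_intros lipschitz_on_continuous_on)
  then have [measurable]: "h \<in> borel_measurable borel"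
    by (rule borel_measurable_continuous_onI)
  have D_meas[measurable]: "D n \<in> borel_measurable borel" for n
    unfolding D_def by measurable
  have h0: "h v = 0" if "1 \<le> norm v" for v
    using fg[OF that] by (simp add: h_def)
  have h: "integrable lborel h"
    using cont by (rule integrable_continuous_bounded_support[where r = 1]) (auto intro: h0)
  have int_D: "(\<integral>v. D n v \<partial>lebesgue) = 0" for n
    unfolding D_def using h lborel_integrable_translation[OF h]
    by (subst integral_completion) (auto simp: lborel_integral_translation)
  have p_int: "integrable lebesgue (\<lambda>v. indicator (ball 0 1) v * (p v \<bullet> e))"
    using f e p by (rule subgradient_integrable_component)
  have q_int: "integrable lebesgue (\<lambda>v. indicator (ball 0 1) v * (q v \<bullet> e))"
    using g e q by (rule subgradient_integrable_component)
  have l_meas: "l \<in> borel_measurable lebesgue"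
    unfolding l_def using p_int q_int by (intro borel_measurable_diff) auto
  \<comment> \<open>The factor \<open>2 * M\<close> comes from the two \<open>M\<close>-Lipschitz
    functions in \<open>h\<close>; radius 2 leaves room for a step of length at most 1 outside the
    unit ball.\<close>
  define w where "w = (\<lambda>v::'a. indicator (cball 0 2) v * (2 * M))"
  have w: "integrable lebesgue w"
    unfolding w_def using integrable_indicator_cball_mult[where 'a='a]
    by (subst integrable_completion) (blast intro: borel_measurable_integrable)+
  have near: "norm (v + (1 / real (Suc n)) *\<^sub>R e) \<ge> norm v - 1 / real (Suc n)" for v n
  proof -
    have "norm ((1 / real (Suc n)) *\<^sub>R e) \<le> 1 / real (Suc n)"
      using e by (simp add: divide_right_mono)
    then show ?thesis
      using norm_triangle_ineq2[of v "- ((1 / real (Suc n)) *\<^sub>R e)"] by simp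
  qed
  have bound: "norm (D n v) \<le> w v" for n v
  proof (cases "norm v \<le> 2")
    case True
    have "D n v = (f (v + (1 / real (Suc n)) *\<^sub>R e) - f v) / (1 / real (Suc n))
        - (g (v + (1 / real (Suc n)) *\<^sub>R e) - g v) / (1 / real (Suc n))"
      by (simp add: D_def h_def algebra_simps)
    then have "\<bar>D n v\<bar> \<le> 2 * M"
      using lipschitz_difference_quotient_le[OF f(2) e, of "1 / real (Suc n)" v]
        lipschitz_difference_quotient_le[OF g(2) e, of "1 / real (Suc n)" v] by auto
    then show ?thesis using True by (simp add: w_def)
  next
    case False
    have "1 / real (Suc n) \<le> 1" by simp
    then have "norm (v + (1 / real (Suc n)) *\<^sub>R e) \<ge> 1"
      using near[of v n] False by linarith
    then show ?thesis using False M by (simp add: D_def h0 w_def)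
  qed
  have lim_f: "AE v in lborel. v \<in> ball 0 1 \<longrightarrow>
      (\<lambda>n. (f (v + (1 / real (Suc n)) *\<^sub>R e) - f v) / (1 / real (Suc n))) \<longlonglongrightarrow> p v \<bullet> e"
    using f e p by (rule AE_difference_quotient_tendsto_subgradient)
  have lim_g: "AE v in lborel. v \<in> ball 0 1 \<longrightarrow>
      (\<lambda>n. (g (v + (1 / real (Suc n)) *\<^sub>R e) - g v) / (1 / real (Suc n))) \<longlonglongrightarrow> q v \<bullet> e"
    using g e q by (rule AE_difference_quotient_tendsto_subgradient)
  \<comment> \<open>\<open>h\<close> may have a kink on the unit sphere, so the convergence of the
    quotients is shown only off it.\<close>
  have sphere: "AE v::'a in lebesgue. v \<notin> sphere 0 1"
    by (intro AE_not_in) (simp add: negligible_sphere flip: negligible_iff_null_sets)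
  have lim: "AE v in lebesgue. (\<lambda>n. D n v) \<longlonglongrightarrow> l v"
    using AE_completion[OF lim_f] AE_completion[OF lim_g] sphere
  proof eventually_elim
    case (elim v)
    show ?case
    proof (cases "v \<in> ball 0 1")
      case True
      then have "(\<lambda>n. (f (v + (1 / real (Suc n)) *\<^sub>R e) - f v) / (1 / real (Suc n))
        - (g (v + (1 / real (Suc n)) *\<^sub>R e) - g v) / (1 / real (Suc n))) \<longlonglongrightarrow> p v \<bullet> e - q v \<bullet> e"
        using elim(1,2) by (intro tendsto_diff) auto
      then show ?thesis using True by (simp add: D_def h_def l_def algebra_simps)
    next
      case False
      then have v: "norm v > 1" using elim(3) by auto
      \<comment> \<open>Once the step is shorter than the distance from \<open>v\<close> to the unit
        ball, both points of the quotient lie where \<open>h\<close> is 0.\<close>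
      then have "\<forall>\<^sub>F n in sequentially. 1 / real (Suc n) < norm v - 1"
        using LIMSEQ_Suc[OF lim_1_over_n[where 'a=real]] by (intro order_tendstoD(2)) auto
      then have "\<forall>\<^sub>F n in sequentially. D n v = 0"
      proof eventually_elim
        case (elim n)
        then have "norm (v + (1 / real (Suc n)) *\<^sub>R e) \<ge> 1" using near[of v n] by linarith
        then show ?case using v by (simp add: D_def h0)
      qed
      moreover have "l v = 0" using False by (simp add: l_def)
      ultimately show ?thesis by (simp add: tendsto_eventually)
    qed
  qed
  have "(\<lambda>n. \<integral>v. D n v \<partial>lebesgue) \<longlonglongrightarrow> (\<integral>v. l v \<partial>lebesgue)"
    by (rule integral_dominated_convergence[OF l_meas _ w lim AE_I2[OF bound]])
       (intro measurable_completion, measurable)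
  then have "(\<integral>v. l v \<partial>lebesgue) = 0"
    unfolding int_D by (simp add: LIMSEQ_const_iff)
  then have "(\<integral>v. indicator (ball 0 1) v * (p v \<bullet> e) \<partial>lebesgue)
    = (\<integral>v. indicator (ball 0 1) v * (q v \<bullet> e) \<partial>lebesgue)"
    unfolding l_def using p_int q_int by simp
  moreover have "(LINT v:ball 0 1|lebesgue. r v) \<bullet> e
    = (\<integral>v. indicator (ball 0 1) v * (r v \<bullet> e) \<partial>lebesgue)"
    if "set_integrable lebesgue (ball 0 1) r" for r :: "'a \<Rightarrow> 'a"
    using that unfolding set_lebesgue_integral_def set_integrable_def
    by (simp flip: integral_inner_left)
  ultimately show "(LINT v:ball 0 1|lebesgue. p v) \<bullet> e = (LINT v:ball 0 1|lebesgue. q v) \<bullet> e"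
    using subgradient_set_integrable[OF f p] subgradient_set_integrable[OF g q] by simp
qed

section \<open>Convex conjugates over a compact set\<close>

text \<open>The convex conjugate of \<open>c\<close> extended by infinity outside \<open>S\<close>.
  For constant \<open>c = R\<close> it is the support function of \<open>S\<close> minus
  \<open>R\<close>; if \<open>W w - v \<bullet> w\<close> has a global minimizer in
  \<open>S\<close>, then \<open>conjugate_on S W v\<close> is minus the concave conjugate of
  \<open>W\<close> at \<open>v\<close>.\<close>

definition conjugate_on :: "'a::real_inner set \<Rightarrow> ('a \<Rightarrow> real) \<Rightarrow> 'a \<Rightarrow> real" where
  "conjugate_on S c v = (SUP y\<in>S. v \<bullet> y - c y)"

context
  fixes S :: "'a::euclidean_space set" and c :: "'a \<Rightarrow> real"
  assumes S: "compact S" "S \<noteq> {}" and c: "continuous_on S c"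
begin

lemma conjugate_on_upper:
  assumes "y \<in> S"
  shows "v \<bullet> y - c y \<le> conjugate_on S c v"
  unfolding conjugate_on_def
proof (rule cSUP_upper[OF assms])
  have "compact ((\<lambda>y. v \<bullet> y - c y) ` S)"
    by (intro compact_continuous_image continuous_intros c S)
  then show "bdd_above ((\<lambda>y. v \<bullet> y - c y) ` S)"
    by (intro bounded_imp_bdd_above compact_imp_bounded)
qed

lemma conjugate_on_least:
  assumes "\<And>y. y \<in> S \<Longrightarrow> v \<bullet> y - c y \<le> b"
  shows "conjugate_on S c v \<le> b"
  unfolding conjugate_on_def using S assms by (intro cSUP_least) auto

lemma convex_conjugate_on: "convex_on UNIV (conjugate_on S c)"
proof (rule convex_onI)
  fix s :: real and u v :: 'a
  assume s: "0 < s" "s < 1"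
  show "conjugate_on S c ((1 - s) *\<^sub>R u + s *\<^sub>R v)
    \<le> (1 - s) * conjugate_on S c u + s * conjugate_on S c v"
  proof (rule conjugate_on_least)
    fix y assume "y \<in> S"
    then have "(1 - s) * (u \<bullet> y - c y) + s * (v \<bullet> y - c y)
      \<le> (1 - s) * conjugate_on S c u + s * conjugate_on S c v"
      using s by (intro add_mono mult_left_mono conjugate_on_upper) auto
    then show "((1 - s) *\<^sub>R u + s *\<^sub>R v) \<bullet> y - c y
      \<le> (1 - s) * conjugate_on S c u + s * conjugate_on S c v"
      by (simp add: algebra_simps)
  qed
qed auto

text \<open>Each affine function of \<open>v\<close> in the supremum has slope \<open>y\<close> with
  \<open>norm y \<le> M\<close>, and suprema preserve a common Lipschitz constant.\<close>

lemma lipschitz_conjugate_on: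
  assumes "S \<subseteq> cball 0 M"
  shows "M-lipschitz_on UNIV (conjugate_on S c)"
proof (rule lipschitz_onI)
  obtain y where "y \<in> S" using S by blast
  then have "norm y \<le> M" using assms by auto
  then show "0 \<le> M" using norm_ge_zero[of y] by linarith
  have le: "conjugate_on S c u \<le> conjugate_on S c v + M * dist u v" for u v
  proof (rule conjugate_on_least)
    fix y assume y: "y \<in> S"
    have "(u - v) \<bullet> y \<le> norm (u - v) * norm y"
      by (rule norm_cauchy_schwarz)
    also have "\<dots> \<le> norm (u - v) * M"
      using y assms by (intro mult_left_mono) auto
    finally show "u \<bullet> y - c y \<le> conjugate_on S c v + M * dist u v"
      using conjugate_on_upper[OF y, of v] by (simp add: dist_norm algebra_simps)
  qed
  show "dist (conjugate_on S c u) (conjugate_on S c v) \<le> M * dist u v" for u v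
    using le[of u v] le[of v u] by (auto simp: dist_real_def abs_le_iff dist_commute)
qed

text \<open>The affine function belonging to \<open>p\<close> lies below the supremum everywhere and
  touches it at \<open>v\<close>. This turns extremal points into subgradients.\<close>

lemma subgradient_conjugate_on:
  assumes "p \<in> S" and "\<And>y. y \<in> S \<Longrightarrow> v \<bullet> y - c y \<le> v \<bullet> p - c p"
  shows "subgradient (conjugate_on S c) v p"
  unfolding subgradient_def
proof
  fix u
  have "conjugate_on S c v \<le> v \<bullet> p - c p"
    using assms(2) by (rule conjugate_on_least)
  then show "conjugate_on S c v + p \<bullet> (u - v) \<le> conjugate_on S c u"
    using conjugate_on_upper[OF assms(1), of u] by (simp add: algebra_simps inner_commute)
qed

end

text \<open>Outside the open unit ball the two conjugates agree: moving from \<open>y\<close> by \<open>R - W y\<close> in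
  direction \<open>v\<close> stays in the sublevel set.\<close>

lemma conjugate_on_sublevel_eq:
  fixes W :: "'a::euclidean_space \<Rightarrow> real"
  assumes W: "1-lipschitz_on UNIV W" and S: "S = {x. W x \<le> R}" "compact S" "S \<noteq> {}"
    and v: "1 \<le> norm v"
  shows "conjugate_on S W v = conjugate_on S (\<lambda>_. R) v"
proof (rule antisym)
  have cont: "continuous_on S W"
    using lipschitz_on_continuous_on[OF W] continuous_on_subset by blast
  note R = conjugate_on_upper[OF S(2,3) continuous_on_const]
  show "conjugate_on S W v \<le> conjugate_on S (\<lambda>_. R) v"
  proof (rule conjugate_on_least[OF S(2,3) cont])
    fix y assume "y \<in> S"
    then have y: "0 \<le> R - W y" using S by auto
    define z where "z = y + (R - W y) *\<^sub>R sgn v"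
    have v0: "v \<noteq> 0" using v by auto
    have "dist z y = R - W y"
      using y v0 by (simp add: z_def dist_norm norm_sgn)
    then have "W z \<le> R"
      using lipschitz_onD[OF W, of z y] by (simp add: dist_real_def)
    then have "z \<in> S" using S by simp
    have "v \<bullet> sgn v = norm v"
      using v0 by (simp add: sgn_div_norm power2_norm_eq_inner[symmetric] power2_eq_square)
    \<comment> \<open>The gain is \<open>(R - W y) * norm v\<close>; here
      \<open>1 \<le> norm v\<close> enters.\<close>
    then have "v \<bullet> y + (R - W y) * 1 \<le> v \<bullet> z"
      unfolding z_def inner_add_right inner_scaleR_right
      using y v by (intro add_left_mono mult_left_mono) auto
    then show "v \<bullet> y - W y \<le> conjugate_on S (\<lambda>_. R) v"
      using R[OF \<open>z \<in> S\<close>, of v R] by simp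
  qed
  show "conjugate_on S (\<lambda>_. R) v \<le> conjugate_on S W v"
  proof (rule conjugate_on_least[OF S(2,3) continuous_on_const])
    fix y assume y: "y \<in> S"
    then show "v \<bullet> y - R \<le> conjugate_on S W v"
      using conjugate_on_upper[OF S(2,3) cont y, of v] S(1) by auto
  qed
qed

section \<open>Steiner points as averages of subgradients\<close>

lemma arg_min_on_attained:
  fixes f :: "'a \<Rightarrow> 'b::linorder"
  assumes "x \<in> S" and "\<And>y. y \<in> S \<Longrightarrow> f x \<le> f y"
  shows "arg_min_on f S \<in> S" and "\<And>y. y \<in> S \<Longrightarrow> f (arg_min_on f S) \<le> f y"
proof -
  have "arg_min_on f S \<in> S \<and> (\<forall>y\<in>S. f (arg_min_on f S) \<le> f y)"
    unfolding arg_min_on_def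
    by (rule arg_minI[where x = x]) (use assms in \<open>auto simp: not_less\<close>)
  then show "arg_min_on f S \<in> S" and "\<And>y. y \<in> S \<Longrightarrow> f (arg_min_on f S) \<le> f y"
    by auto
qed

lemma arg_max_on_attained:
  fixes f :: "'a \<Rightarrow> 'b::linorder"
  assumes "x \<in> S" and "\<And>y. y \<in> S \<Longrightarrow> f y \<le> f x"
  shows "arg_max_on f S \<in> S" and "\<And>y. y \<in> S \<Longrightarrow> f y \<le> f (arg_max_on f S)"
proof -
  have "arg_max_on f S \<in> S \<and> (\<forall>y\<in>S. f y \<le> f (arg_max_on f S))"
    unfolding arg_max_on_def
    by (rule arg_maxI[where x = x]) (use assms in \<open>auto simp: not_less\<close>)
  then show "arg_max_on f S \<in> S" and "\<And>y. y \<in> S \<Longrightarrow> f y \<le> f (arg_max_on f S)"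
    by auto
qed

text \<open>The maximizers defining \<open>steiner_point S\<close> are subgradients of the conjugate
  of the constant \<open>R\<close>, the points \<open>p v\<close> are subgradients of the conjugate
  of \<open>W\<close>, and the two conjugates agree outside the open unit ball. Leaving
  \<open>p\<close> arbitrary lets the result serve both \<open>work_fun_next\<close> and
  \<open>work_fun\<close>.\<close>

lemma steiner_point_sublevel:
  fixes W :: "'a::euclidean_space \<Rightarrow> real"
  assumes W: "1-lipschitz_on UNIV W" and S: "S = {x. W x \<le> R}" "compact S" "S \<noteq> {}"
    and p: "\<And>v. v \<in> ball 0 1 \<Longrightarrow> p v \<in> S"
      "\<And>v y. \<lbrakk>v \<in> ball 0 1; y \<in> S\<rbrakk> \<Longrightarrow> W (p v) - v \<bullet> p v \<le> W y - v \<bullet> y"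
  shows "set_integrable lebesgue (ball 0 1) p"
    and "steiner_point S = (1 / measure lebesgue (cball (0::'a) 1)) *\<^sub>R (LINT v:cball 0 1|lebesgue. p v)"
proof -
  define q where "q = (\<lambda>v. arg_max_on (\<lambda>x. v \<bullet> x) S)"
  have cont: "continuous_on S W"
    using lipschitz_on_continuous_on[OF W] continuous_on_subset by blast
  obtain M where "\<And>x. x \<in> S \<Longrightarrow> norm x \<le> M"
    using compact_imp_bounded[OF S(2)] unfolding bounded_iff by blast
  then have M: "S \<subseteq> cball 0 M" by auto
  have q: "q v \<in> S" "\<And>y. y \<in> S \<Longrightarrow> v \<bullet> y \<le> v \<bullet> q v" for v
  proof -
    obtain x where "x \<in> S" "\<And>y. y \<in> S \<Longrightarrow> v \<bullet> y \<le> v \<bullet> x"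
      using continuous_attains_sup[OF S(2,3), of "\<lambda>x. v \<bullet> x"]
        continuous_on_inner[OF continuous_on_const continuous_on_id] by blast
    note x = this
    show "q v \<in> S" unfolding q_def using x by (rule arg_max_on_attained(1))
    show "v \<bullet> y \<le> v \<bullet> q v" if "y \<in> S" for y
      unfolding q_def using x that by (rule arg_max_on_attained(2))
  qed
  note cW = convex_conjugate_on[OF S(2,3) cont] lipschitz_conjugate_on[OF S(2,3) cont M]
  note cR = convex_conjugate_on[OF S(2,3) continuous_on_const]
    lipschitz_conjugate_on[OF S(2,3) continuous_on_const M]
  have sp: "subgradient (conjugate_on S W) v (p v)" if "v \<in> ball 0 1" for v
    using p[OF that] by (intro subgradient_conjugate_on S cont) (auto simp: algebra_simps)
  have sq: "subgradient (conjugate_on S (\<lambda>_. R)) v (q v)" for v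
    using q by (intro subgradient_conjugate_on S continuous_on_const) auto
  show p_int: "set_integrable lebesgue (ball 0 1) p"
    using cW sp by (rule subgradient_set_integrable)
  have q_int: "set_integrable lebesgue (ball 0 1) q"
    using cR sq by (rule subgradient_set_integrable)
  have "(LINT v:ball 0 1|lebesgue. q v) = (LINT v:ball 0 1|lebesgue. p v)"
    by (rule subgradient_integral_eq[OF cR sq cW sp])
       (auto intro: conjugate_on_sublevel_eq[OF W S, symmetric])
  then show "steiner_point S
    = (1 / measure lebesgue (cball (0::'a) 1)) *\<^sub>R (LINT v:cball 0 1|lebesgue. p v)"
    unfolding steiner_point_def
    using set_integral_cball_eq_ball[OF p_int] set_integral_cball_eq_ball[OF q_int]
    by (simp add: q_def)
qed

text \<open>Otherwise a hyperplane strictly separates the average from \<open>S\<close>; integrating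
  \<open>b < a \<bullet> p v\<close> over the ball puts the average on the side of
  \<open>S\<close>.\<close>

lemma ball_average_mem_convex:
  fixes p :: "'a::euclidean_space \<Rightarrow> 'a"
  assumes S: "convex S" "closed S" and p: "\<And>v. v \<in> ball 0 1 \<Longrightarrow> p v \<in> S"
    and int: "set_integrable lebesgue (ball 0 1) p"
  shows "(1 / measure lebesgue (cball (0::'a) 1)) *\<^sub>R (LINT v:cball 0 1|lebesgue. p v) \<in> S"
proof (rule ccontr)
  define vol where "vol = measure lebesgue (cball (0::'a) 1)"
  define I where "I = (LINT v:cball 0 1|lebesgue. p v)"
  assume "\<not> ?thesis"
  then obtain a b where ab: "a \<bullet> ((1 / vol) *\<^sub>R I) < b" "\<And>x. x \<in> S \<Longrightarrow> b < a \<bullet> x"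
    using separating_hyperplane_closed_point[OF S] unfolding vol_def I_def by metis
  have vol: "vol > 0" "vol = measure lebesgue (ball (0::'a) 1)"
    unfolding vol_def by (simp_all add: content_cball_pos content_cball_conv_ball)
  have "vol * b = (\<integral>v. indicator (ball (0::'a) 1) v * b \<partial>lebesgue)"
    using vol by simp
  also have "\<dots> \<le> (\<integral>v. (indicator (ball 0 1) v *\<^sub>R p v) \<bullet> a \<partial>lebesgue)"
  proof (rule Bochner_Integration.integral_mono)
    show "integrable lebesgue (\<lambda>v. indicator (ball (0::'a) 1) v * b)"
      by (intro integrable_mult_left integrable_real_indicator)
       (use emeasure_bounded_finite[of "ball (0::'a) 1"] in auto)
    show "integrable lebesgue (\<lambda>v. (indicator (ball 0 1) v *\<^sub>R p v) \<bullet> a)"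
      using int unfolding set_integrable_def by (intro integrable_inner_left)
    show "indicator (ball 0 1) v * b \<le> (indicator (ball 0 1) v *\<^sub>R p v) \<bullet> a" for v
      using ab(2)[OF p, of v] by (auto simp: indicator_def inner_commute less_imp_le)
  qed
  also have "\<dots> = I \<bullet> a"
    using int unfolding I_def set_integral_cball_eq_ball[OF int]
    unfolding set_lebesgue_integral_def set_integrable_def by (intro integral_inner_left)
  finally have "vol * b \<le> I \<bullet> a" .
  then show False
    using ab(1) vol(1) by (simp add: field_simps inner_commute)
qed

section \<open>Work functions and the minimizers of their tilts\<close>

lemma path_cost_Suc:
  "path_cost (Suc t) p x = path_cost t p (p (Suc t)) + dist (p (Suc t)) x"
  by (simp add: path_cost_def)

lemma path_cost_nonneg: "0 \<le> path_cost t p x"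
  unfolding path_cost_def by (intro add_nonneg_nonneg sum_nonneg) auto

lemma work_fun_le: "satisfies_requests K t p \<Longrightarrow> work_fun K t x \<le> path_cost t p x"
  unfolding work_fun_def
  by (rule cINF_lower) (auto intro!: bdd_belowI[where m = 0] path_cost_nonneg)

text \<open>A real infimum over the empty set is an unspecified value, so a feasible path must
  exist; any selection from the nonempty requests is one.\<close>

lemma work_fun_greatest:
  assumes "\<forall>s\<in>{1..t}. K s \<noteq> {}"
    and "\<And>p. satisfies_requests K t p \<Longrightarrow> b \<le> path_cost t p x"
  shows "b \<le> work_fun K t x"
  unfolding work_fun_def
proof (rule cINF_greatest)
  have "satisfies_requests K t (\<lambda>s. if s = 0 then 0 else SOME y. y \<in> K s)"
    using assms(1) by (auto simp: satisfies_requests_def some_in_eq)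
  then show "{p. satisfies_requests K t p} \<noteq> {}" by blast
qed (use assms(2) in auto)

text \<open>A path ending at \<open>y\<close> is redirected to \<open>x\<close> by changing only its
  last leg.\<close>

lemma work_fun_triangle:
  assumes "\<forall>s\<in>{1..t}. K s \<noteq> {}"
  shows "work_fun K t x \<le> work_fun K t y + dist y x"
proof -
  have "work_fun K t x - dist y x \<le> work_fun K t y"
  proof (rule work_fun_greatest[OF assms])
    fix p assume "satisfies_requests K t p"
    then have "work_fun K t x \<le> path_cost t p x" by (rule work_fun_le)
    also have "\<dots> \<le> path_cost t p y + dist y x"
      using dist_triangle[of "p t" x y] by (simp add: path_cost_def)
    finally show "work_fun K t x - dist y x \<le> path_cost t p y" by simp
  qed
  then show ?thesis by simp
qed

lemma lipschitz_work_fun: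
  assumes "\<forall>s\<in>{1..t}. K s \<noteq> {}"
  shows "1-lipschitz_on UNIV (work_fun K t)"
proof (rule lipschitz_onI)
  fix x y
  show "dist (work_fun K t x) (work_fun K t y) \<le> 1 * dist x y"
    using work_fun_triangle[OF assms, where x = x and y = y]
      work_fun_triangle[OF assms, where x = y and y = x]
    by (simp add: dist_real_def abs_le_iff dist_commute)
qed simp

text \<open>Dynamic programming: the last leg of a path starts at its position \<open>p t\<close> in
  \<open>K t\<close>, and compactness provides a best starting point. At time 0 the last leg would
  start at the origin instead, hence \<open>1 \<le> t\<close>.\<close>

lemma work_fun_last_request:
  assumes ne: "\<forall>s\<in>{1..t}. K s \<noteq> {}" and "1 \<le> t" and "compact (K t)"
  obtains y where "y \<in> K t" and "work_fun K t x = work_fun K t y + dist y x"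
proof -
  have "continuous_on (K t) (work_fun K t)"
    using lipschitz_on_continuous_on[OF lipschitz_work_fun[OF ne]] continuous_on_subset by blast
  then have "continuous_on (K t) (\<lambda>y. work_fun K t y + dist y x)"
    by (intro continuous_intros)
  then obtain y where y: "y \<in> K t"
      "\<And>z. z \<in> K t \<Longrightarrow> work_fun K t y + dist y x \<le> work_fun K t z + dist z x"
    using continuous_attains_inf[OF \<open>compact (K t)\<close>, of "\<lambda>y. work_fun K t y + dist y x"]
      ne \<open>1 \<le> t\<close> by (meson atLeastAtMost_iff order_refl)
  have "work_fun K t y + dist y x \<le> work_fun K t x"
  proof (rule work_fun_greatest[OF ne])
    fix p assume p: "satisfies_requests K t p"
    then have "p t \<in> K t" using \<open>1 \<le> t\<close> by (auto simp: satisfies_requests_def)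
    then have "work_fun K t y + dist y x \<le> work_fun K t (p t) + dist (p t) x" by (rule y)
    also have "\<dots> \<le> path_cost t p (p t) + dist (p t) x"
      using work_fun_le[OF p] by simp
    also have "\<dots> = path_cost t p x" by (simp add: path_cost_def)
    finally show "work_fun K t y + dist y x \<le> path_cost t p x" .
  qed
  with y(1) work_fun_triangle[OF ne, where x = x and y = y] show thesis
    by (intro that) auto
qed

text \<open>A path ending at \<open>y\<close> serves the additional request \<open>L\<close> for
  free by stopping there. Conversely, omitting the stop in \<open>L\<close> does not lengthen a
  path, by the triangle inequality.\<close>

lemma work_fun_next_eq:
  assumes ne: "\<forall>s\<in>{1..t}. K s \<noteq> {}" and "y \<in> L"
  shows "work_fun_next K t L y = work_fun K t y"
proof (rule antisym)
  have ne': "\<forall>s\<in>{1..Suc t}. (K(Suc t := L)) s \<noteq> {}"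
    using ne \<open>y \<in> L\<close> by auto
  show "work_fun_next K t L y \<le> work_fun K t y"
  proof (rule work_fun_greatest[OF ne])
    fix p assume p: "satisfies_requests K t p"
    then have "satisfies_requests (K(Suc t := L)) (Suc t) (p(Suc t := y))"
      using \<open>y \<in> L\<close> by (auto simp: satisfies_requests_def)
    then have "work_fun_next K t L y \<le> path_cost (Suc t) (p(Suc t := y)) y"
      unfolding work_fun_next_def by (rule work_fun_le)
    also have "\<dots> = path_cost t p y"
      by (auto simp: path_cost_Suc path_cost_def intro!: sum.cong)
    finally show "work_fun_next K t L y \<le> path_cost t p y" .
  qed
  show "work_fun K t y \<le> work_fun_next K t L y"
    unfolding work_fun_next_def
  proof (rule work_fun_greatest[OF ne'])
    fix p assume "satisfies_requests (K(Suc t := L)) (Suc t) p"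
    then have "p 0 = 0" and req: "\<And>s. s \<in> {1..Suc t} \<Longrightarrow> p s \<in> (K(Suc t := L)) s"
      by (simp_all add: satisfies_requests_def)
    moreover have "p s \<in> K s" if "s \<in> {1..t}" for s
      using req[of s] that by (simp split: if_splits)
    ultimately have "satisfies_requests K t p"
      by (simp add: satisfies_requests_def)
    then have "work_fun K t (p (Suc t)) \<le> path_cost t p (p (Suc t))" by (rule work_fun_le)
    then show "work_fun K t y \<le> path_cost (Suc t) p y"
      using work_fun_triangle[OF ne, where x = y and y = "p (Suc t)"] by (simp add: path_cost_Suc)
  qed
qed

text \<open>Going from \<open>y\<close> to \<open>x\<close> costs \<open>dist y x\<close> but gains
  at most \<open>norm v * dist y x\<close> by Cauchy-Schwarz.\<close>

lemma minus_inner_less: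
  fixes v x y :: "'a::real_inner"
  assumes "norm v < 1" and "x \<noteq> y" and "U x = U y + dist y x"
  shows "U y - v \<bullet> y < U x - v \<bullet> x"
proof -
  have "v \<bullet> (x - y) \<le> norm v * norm (x - y)" by (rule norm_cauchy_schwarz)
  also have "\<dots> < norm (x - y)" using assms by simp
  finally show ?thesis using assms(3) by (simp add: dist_norm norm_minus_commute inner_diff_right)
qed

text \<open>\<open>arg_min_on\<close> is a choice operator, so a global minimizer has to be
  exhibited first: compactness gives one over \<open>S\<close>, and any other point is strictly
  worse than the point of \<open>S\<close> from which its last leg starts. The same comparison
  forces every global minimizer into \<open>S\<close>.\<close>

lemma arg_min_on_minus_inner:
  fixes U :: "'a::euclidean_space \<Rightarrow> real"
  assumes S: "compact S" "S \<noteq> {}" and U: "continuous_on S U"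
    and decomp: "\<And>x. \<exists>y\<in>S. U x = U y + dist y x" and v: "norm v < 1"
  defines "m \<equiv> arg_min_on (\<lambda>w. U w - v \<bullet> w) UNIV"
  shows "m \<in> S" and "U m - v \<bullet> m \<le> U x - v \<bullet> x"
proof -
  have "continuous_on S (\<lambda>w. U w - v \<bullet> w)"
    by (intro continuous_intros U)
  then obtain z where z: "z \<in> S" "\<And>y. y \<in> S \<Longrightarrow> U z - v \<bullet> z \<le> U y - v \<bullet> y"
    using continuous_attains_inf[OF S, of "\<lambda>w. U w - v \<bullet> w"] by blast
  have "U z - v \<bullet> z \<le> U w - v \<bullet> w" for w
  proof -
    obtain y where y: "y \<in> S" "U w = U y + dist y w" using decomp by blast
    show ?thesis
      using z(2)[OF y(1)] minus_inner_less[OF v _ y(2)] by (cases "w = y") auto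
  qed
  then have m: "U m - v \<bullet> m \<le> U w - v \<bullet> w" for w
    unfolding m_def by (intro arg_min_on_attained(2)[where x = z]) auto
  show "U m - v \<bullet> m \<le> U x - v \<bullet> x" by (rule m)
  obtain y where y: "y \<in> S" "U m = U y + dist y m" using decomp by blast
  show "m \<in> S"
    using y(1) m[of y] minus_inner_less[OF v _ y(2)] by (cases "m = y") auto
qed

section \<open>Steiner points of level sets of the work function\<close>

theorem theorem6p8:
  fixes K :: "nat \<Rightarrow> 'a::euclidean_space set" and t :: nat and R :: real
  assumes "1 \<le> t"
    and "\<And>s. s \<in> {1..t} \<Longrightarrow> convex_body (K s)"
    and "R \<ge> (INF x. work_fun K t x)"
  shows "steiner_point (level_set K t R)
           = functional_steiner_point (work_fun_next K t (level_set K t R))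
         \<and> steiner_point (level_set K t R) \<in> K t
         \<and> ((\<forall>s\<in>{1..t}. K s \<subseteq> level_set K t R) \<longrightarrow>
              steiner_point (level_set K t R) = functional_steiner_point (work_fun K t))"
proof -
  define W where "W = work_fun K t"
  define L where "L = level_set K t R"
  define V where "V = work_fun_next K t L"
  have ne: "\<forall>s\<in>{1..t}. K s \<noteq> {}"
    using assms(2) by (simp add: convex_body_def)
  have Kt: "convex (K t)" "compact (K t)" "K t \<noteq> {}"
    using assms(1,2) by (auto simp: convex_body_def)
  have W: "1-lipschitz_on UNIV W"
    unfolding W_def using ne by (rule lipschitz_work_fun)
  have contW: "continuous_on A W" for A
    using lipschitz_on_continuous_on[OF W] continuous_on_subset by blast
  have decW: "\<exists>y\<in>K t. W x = W y + dist y x" for x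
    unfolding W_def using ne assms(1) Kt(2) by (rule work_fun_last_request) blast
  have L: "L = {x. W x \<le> R}"
    by (simp add: L_def W_def level_set_def)
  obtain z where z: "z \<in> K t" "\<And>y. y \<in> K t \<Longrightarrow> W z \<le> W y"
    using continuous_attains_inf[OF Kt(2,3) contW] by auto
  \<comment> \<open>The infimum of \<open>W\<close> is attained in \<open>K t\<close>, which makes
    the level set nonempty even when \<open>R\<close> equals that infimum.\<close>
  have "W z \<le> W x" for x
  proof -
    obtain y where "y \<in> K t" "W x = W y + dist y x" using decW by blast
    then show ?thesis using z(2)[of y] zero_le_dist[of y x] by linarith
  qed
  then have "W z \<le> (INF x. W x)" by (intro cINF_greatest) auto
  then have "z \<in> L" using assms(3) L by (simp add: W_def)
  then have "L \<noteq> {}" by blast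
  have "compact L"
    unfolding compact_eq_bounded_closed
  proof
    have "closed (W -` {..R})"
      using contW[of UNIV] by (intro continuous_closed_vimage) (auto simp: continuous_on_eq_continuous_at)
    then show "closed L" by (simp add: L vimage_def)
    obtain B where B: "\<And>y. y \<in> K t \<Longrightarrow> norm y \<le> B"
      using compact_imp_bounded[OF Kt(2)] unfolding bounded_iff by blast
    \<comment> \<open>The last leg from \<open>K t\<close> to \<open>x\<close> has length
      \<open>W x - W y\<close>, which is at most \<open>R - W z\<close>.\<close>
    have "norm x \<le> B + (R - W z)" if "x \<in> L" for x
    proof -
      obtain y where y: "y \<in> K t" "W x = W y + dist y x" using decW by blast
      have "norm x \<le> norm y + dist y x" using norm_triangle_sub[of x y] by (simp add: dist_norm norm_minus_commute)
      then show ?thesis using B[OF y(1)] y z(2)[OF y(1)] that L by auto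
    qed
    then show "bounded L" unfolding bounded_iff by blast
  qed
  note L' = L \<open>compact L\<close> \<open>L \<noteq> {}\<close>
  have VW: "V y = W y" if "y \<in> L" for y
    unfolding V_def W_def using ne that by (rule work_fun_next_eq)
  \<comment> \<open>For \<open>V\<close> the last request is \<open>L\<close> itself. Hence the
    tilted minimizers of \<open>V\<close> lie in \<open>L\<close>, where \<open>V\<close> and
    \<open>W\<close> agree, and so they minimize the tilted \<open>W\<close> over
    \<open>L\<close>.\<close>
  have decV: "\<exists>y\<in>L. V x = V y + dist y x" for x
  proof -
    have "\<forall>s\<in>{1..Suc t}. (K(Suc t := L)) s \<noteq> {}"
      using ne \<open>L \<noteq> {}\<close> by auto
    moreover have "compact ((K(Suc t := L)) (Suc t))"
      using \<open>compact L\<close> by simp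
    moreover have "1 \<le> Suc t" by simp
    ultimately obtain y where "y \<in> (K(Suc t := L)) (Suc t)" "V x = V y + dist y x"
      unfolding V_def work_fun_next_def using work_fun_last_request by blast
    then show ?thesis by auto
  qed
  have contV: "continuous_on L V"
    using contW[of L] VW by (simp cong: continuous_on_cong)
  define p where "p = (\<lambda>v. arg_min_on (\<lambda>w. V w - v \<bullet> w) UNIV)"
  have p: "p v \<in> L" "W (p v) - v \<bullet> p v \<le> W y - v \<bullet> y" if "v \<in> ball 0 1" "y \<in> L" for v y
  proof -
    have v: "norm v < 1" using that by simp
    show pL: "p v \<in> L"
      unfolding p_def by (rule arg_min_on_minus_inner(1)[OF L'(2,3) contV decV v])
    have "V (p v) - v \<bullet> p v \<le> V y - v \<bullet> y"
      unfolding p_def by (rule arg_min_on_minus_inner(2)[OF L'(2,3) contV decV v])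
    then show "W (p v) - v \<bullet> p v \<le> W y - v \<bullet> y"
      using VW pL that by simp
  qed
  \<comment> \<open>The last leg to \<open>p v\<close> starts at some \<open>y\<close> in
    \<open>K t\<close>. As \<open>W y \<le> W (p v) \<le> R\<close>, this \<open>y\<close> competes
    in \<open>L\<close>, and it would be strictly better than \<open>p v\<close> unless equal to
    it.\<close>
  have pK: "p v \<in> K t" if "v \<in> ball 0 1" for v
  proof -
    obtain y where y: "y \<in> K t" "W (p v) = W y + dist y (p v)" using decW by blast
    have "W (p v) \<le> R" using p(1)[OF that \<open>z \<in> L\<close>] L by simp
    then have "W y \<le> R" using y(2) zero_le_dist[of y "p v"] by linarith
    then have "y \<in> L" using L by simp
    then have "W (p v) - v \<bullet> p v \<le> W y - v \<bullet> y" by (rule p(2)[OF that])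
    then have "p v = y"
      using minus_inner_less[of v "p v" y W] y(2) that by fastforce
    then show ?thesis using y(1) by simp
  qed
  have p_int: "set_integrable lebesgue (ball 0 1) p"
    using \<open>z \<in> L\<close> p by (intro steiner_point_sublevel(1)[OF W L']) auto
  have s: "steiner_point L
      = (1 / measure lebesgue (cball (0::'a) 1)) *\<^sub>R (LINT v:cball 0 1|lebesgue. p v)"
    using \<open>z \<in> L\<close> p by (intro steiner_point_sublevel(2)[OF W L']) auto
  have sV: "steiner_point L = functional_steiner_point V"
    using s by (simp add: functional_steiner_point_def p_def)
  have sK: "steiner_point L \<in> K t"
    unfolding s using Kt(1) compact_imp_closed[OF Kt(2)] pK p_int by (rule ball_average_mem_convex)
  \<comment> \<open>The tilted minimizers of \<open>W\<close> over the whole space lie in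
    \<open>K t\<close>, hence in \<open>L\<close>, and so are admissible points for
    \<open>steiner_point_sublevel\<close>.\<close>
  have sW: "steiner_point L = functional_steiner_point W" if "K t \<subseteq> L"
  proof -
    have q: "arg_min_on (\<lambda>w. W w - v \<bullet> w) UNIV \<in> L"
      "W (arg_min_on (\<lambda>w. W w - v \<bullet> w) UNIV) - v \<bullet> arg_min_on (\<lambda>w. W w - v \<bullet> w) UNIV
        \<le> W y - v \<bullet> y" if "v \<in> ball 0 1" for v y
      using arg_min_on_minus_inner[OF Kt(2,3) contW decW, of v] that \<open>K t \<subseteq> L\<close> by auto
    show ?thesis
      unfolding functional_steiner_point_def
      by (rule steiner_point_sublevel(2)[OF W L' q])
  qed
  show ?thesis
    using sV sK sW assms(1) unfolding V_def W_def L_def by auto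
qed

end
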